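(* Let $n\ge 1$ and let $p(x)=\sum_{a\in\mathcal A}c_a x^a$ be a homogeneous posynomial in $n$ variables of degree $d>0$. Suppose that $p$ is $\Gamma_1$-stable, i.e. the principal branch of $p$ has no zero $z=(z_1,\dots,z_n)\in\mathbb C^n$ with $\operatorname{Re} z_i>0$ for all $i$. Then the function $x\mapsto p(x)^{1/d}$ is concave on $\mathbb R_{>0}^n$. In particular, $\log p$ is concave on $\mathbb R_{>0}^n$.
   Context: A posynomial in $n$ variables is a finite sum $p(x)=\sum_{a\in\mathcal A}c_a x^a=\sum_{a\in\mathcal A}c_a\prod_{i=1}^n x_i^{a_i}$, where $\mathcal A\subset\mathbb R_{\ge 0}^n$ is finite and $c_a>0$ for every $a\in\mathcal A$ (exponents are arbitrary nonnegative reals). It is homogeneous of degree $d$ if $\sum_i a_i=d$ for every $a\in\mathcal A$. On $\mathbb C\setminus(-\infty,0]$ real powers are defined using the principal logarithm, $z^{s}=\exp(s\operatorname{Log} z)$ with $\operatorname{Im}\operatorname{Log} z\in(-\pi,\pi)$; this defines a holomorphic function $p$ (the principal branch) on $(\mathbb C\setminus(-\infty,0])^n$. For $0<\alpha\le 1$, $\Gamma_\alpha=\{re^{i\theta}: r>0,\ |\theta|<\alpha\pi/2\}$; in particular $\Gamma_1$ is the open right half-plane. The posynomial $p$ is $\Gamma_\alpha$-stable if its principal branch has no zero on $\Gamma_\alpha^n$. *)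

theory Defs
  imports "HOL-Analysis.Analysis"
begin

(* A posynomial is given by its exponent set A and its coefficient function c; only the
   values of c on A matter. *)
definition posynomial :: "(real ^ 'n) set \<Rightarrow> (real ^ 'n \<Rightarrow> real) \<Rightarrow> bool" where
  "posynomial A c \<longleftrightarrow> finite A \<and> (\<forall>a\<in>A. (\<forall>i. 0 \<le> a $ i) \<and> 0 < c a)"

definition homogeneous_of_degree :: "(real ^ 'n) set \<Rightarrow> real \<Rightarrow> bool" where
  "homogeneous_of_degree A d \<longleftrightarrow> (\<forall>a\<in>A. (\<Sum>i\<in>UNIV. a $ i) = d)"

definition posy :: "(real ^ 'n) set \<Rightarrow> (real ^ 'n \<Rightarrow> real) \<Rightarrow> real ^ 'n \<Rightarrow> real" where
  "posy A c x = (\<Sum>a\<in>A. c a * (\<Prod>i\<in>UNIV. x $ i powr a $ i))"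

(* Complex powr is z powr s = exp (s * Ln z) for z \<noteq> 0, with Ln the principal logarithm, so this
   is the principal branch when no coordinate lies in (-\<infinity>, 0]. It is used only there. *)
definition posy_complex ::
    "(real ^ 'n) set \<Rightarrow> (real ^ 'n \<Rightarrow> real) \<Rightarrow> complex ^ 'n \<Rightarrow> complex" where
  "posy_complex A c z = (\<Sum>a\<in>A. of_real (c a) * (\<Prod>i\<in>UNIV. z $ i powr of_real (a $ i)))"

definition sector :: "real \<Rightarrow> complex set" where
  "sector \<alpha> = {rcis r \<theta> | r \<theta>. 0 < r \<and> \<bar>\<theta>\<bar> < \<alpha> * pi / 2}"

(* Meant for 0 < \<alpha> \<le> 1. *)
definition sector_stable :: "real \<Rightarrow> (real ^ 'n) set \<Rightarrow> (real ^ 'n \<Rightarrow> real) \<Rightarrow> bool" where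
  "sector_stable \<alpha> A c \<longleftrightarrow>
     (\<forall>z :: complex ^ 'n. (\<forall>i. z $ i \<in> sector \<alpha>) \<longrightarrow> posy_complex A c z \<noteq> 0)"

lemma sector_1: "sector 1 = {z. 0 < Re z}"
proof (intro equalityI subsetI)
  fix z assume "z \<in> sector 1"
  then obtain r t where "0 < r" "\<bar>t\<bar> < pi / 2" "z = rcis r t"
    by (auto simp: sector_def)
  then show "z \<in> {z. 0 < Re z}"
    using cos_gt_zero_pi[of t] by auto
next
  fix z :: complex assume "z \<in> {z. 0 < Re z}"
  then have z: "z \<noteq> 0" "0 < Re z"
    by auto
  have "\<bar>Arg z\<bar> < pi / 2"
    using Re_Ln_pos_lt_imp[OF z(2)] Arg_eq_Im_Ln[OF z(1)] by simp
  with z(1) show "z \<in> sector 1"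
    unfolding sector_def mem_Collect_eq
    by (intro exI[of _ "cmod z"] exI[of _ "Arg z"]) (simp add: rcis_cmod_Arg)
qed

lemma posy_complex_of_real:
  assumes "\<And>i. 0 < x $ i"
  shows "posy_complex A c (\<chi> i. of_real (x $ i)) = of_real (posy A c x)"
  using assms by (simp add: posy_complex_def posy_def powr_of_real less_imp_le)

end

theory Submission
  imports Defs "HOL-Complex_Analysis.Conformal_Mappings"
begin

text \<open>
  Let \<open>P w = (\<Sum>a. c a * exp (a \<bullet> w))\<close> be the posynomial in logarithmic coordinates; by stability and
  homogeneity it has no zero where the imaginary parts of the coordinates differ by less than
  \<open>\<pi>\<close>, so it has a logarithm \<open>G\<close> there, real at real points.

  The key point concerns one variable: if \<open>R z = (\<Sum>k. C\<^sub>k * exp (k * z))\<close> with \<open>C\<^sub>k > 0\<close>, \<open>k \<ge> 0\<close> has no zero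
  in \<open>\<bar>Im z\<bar> < \<pi>\<close>, then \<open>Im (log (R z)) \<ge> 0\<close> for \<open>0 \<le> Im z < \<pi>\<close>. For \<open>0 < \<eta> < \<pi>\<close> the
  quotient \<open>R (z - 2 * \<eta> * \<i>) / R z\<close> has modulus at most 1 for \<open>0 \<le> Im z \<le> \<eta>\<close>: on the lower edge because
  the \<open>C\<^sub>k\<close> are positive, on the upper edge because the two arguments are conjugate, and asymptotically
  as \<open>Re z\<close> tends to \<open>\<plusminus>\<infinity>\<close>. Hence \<open>\<bar>R\<bar>\<close> decreases on vertical segments,
  which by the Cauchy-Riemann equations makes \<open>Im (log R)\<close> increase along horizontal lines, starting from
  a nonnegative limit.

  Restricting \<open>P\<close> to complex lines gives \<open>0 \<le> Im G \<le> d * \<pi>\<close> where all imaginary parts are in \<open>[0, \<pi>)\<close>.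
  So for positive \<open>x\<close>, \<open>y\<close> the function \<open>f s = p (x + s * y) powr (1 / d)\<close> maps the upper half-plane to its
  closure. The maximum principle improves this to \<open>Im (f s - s * p y powr (1 / d)) \<ge> 0\<close>, so
  \<open>f s - s * p y powr (1 / d)\<close> is nondecreasing for \<open>s \<ge> 0\<close>. Comparing \<open>s = 0\<close> and \<open>s = 1\<close> shows that
  \<open>p powr (1 / d)\<close> is superadditive, hence concave, being homogeneous of degree 1.
\<close>

subsection \<open>Continuous logarithms\<close>

text \<open>Two logarithms of one function differ by multiples of \<open>2 * pi * \<i>\<close>, so
  their difference is continuous with discrete range, hence constant on a connected set.\<close>

lemma continuous_log_unique:
  fixes f g :: "'a::real_normed_vector \<Rightarrow> complex"
  assumes "connected S" "continuous_on S f" "continuous_on S g"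
    and "\<And>z. z \<in> S \<Longrightarrow> exp (f z) = exp (g z)"
    and "a \<in> S" "f a = g a" "z \<in> S"
  shows "f z = g z"
proof -
  have "(\<lambda>x. f x - g x) constant_on S"
  proof (rule continuous_discrete_range_constant[OF assms(1)])
    show "continuous_on S (\<lambda>x. f x - g x)"
      using assms by (intro continuous_intros)
    fix x assume x: "x \<in> S"
    show "\<exists>e>0. \<forall>y. y \<in> S \<and> f y - g y \<noteq> f x - g x \<longrightarrow> e \<le> norm ((f y - g y) - (f x - g x))"
    proof (intro exI[of _ "2*pi"] conjI allI impI)
      fix y assume y: "y \<in> S \<and> f y - g y \<noteq> f x - g x"
      have "exp (f y - g y) = exp (f x - g x)"
        using assms(4) x y by (simp add: exp_diff)
      then obtain n :: int where n: "f y - g y = f x - g x + (of_int (2 * n) * pi) * \<i>"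
        using exp_eq by metis
      with y have "n \<noteq> 0"
        by auto
      then have "1 \<le> \<bar>n\<bar>"
        by simp
      then have "1 \<le> real_of_int \<bar>n\<bar>"
        by linarith
      with pi_gt_zero show "2 * pi \<le> norm ((f y - g y) - (f x - g x))"
        unfolding n by (simp add: norm_mult)
    qed simp
  qed
  then obtain k where k: "\<And>x. x \<in> S \<Longrightarrow> f x - g x = k"
    by (auto simp: constant_on_def)
  show ?thesis
    using k[OF assms(5)] k[OF assms(7)] assms(6) by simp
qed

text \<open>Near \<open>z\<close> the values of \<open>f\<close> stay within \<open>pi\<close> of
  \<open>f z\<close>, so \<open>f\<close> is there a constant plus the principal logarithm of a
  holomorphic quotient that equals 1 at \<open>z\<close>.\<close>

lemma continuous_log_holomorphic:
  assumes "open S" "continuous_on S f" "(\<lambda>z. exp (f z)) holomorphic_on S"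
  shows "f holomorphic_on S"
  unfolding holomorphic_on_open[OF assms(1)]
proof (intro ballI)
  fix z assume z: "z \<in> S"
  have "\<forall>\<^sub>F w in nhds z. f w \<in> ball (f z) pi"
  proof -
    have "(f \<longlongrightarrow> f z) (nhds z)"
      using assms z continuous_on_eq_continuous_at[of S f]
      by (simp add: isCont_def tendsto_at_iff_tendsto_nhds)
    then show ?thesis
      using pi_gt_zero by (intro topological_tendstoD) auto
  qed
  moreover have "\<forall>\<^sub>F w in nhds z. w \<in> S"
    using assms(1) z by (simp add: eventually_nhds_in_open)
  ultimately have eq: "\<forall>\<^sub>F w in nhds z. f w = f z + Ln (exp (f w) / exp (f z))"
  proof eventually_elim
    case (elim w)
    have "\<bar>Im (f w - f z)\<bar> < pi"
      using elim(1) abs_Im_le_cmod[of "f w - f z"] by (simp add: dist_norm norm_minus_commute)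
    then have "Ln (exp (f w - f z)) = f w - f z"
      by (intro Ln_exp) auto
    then show ?case
      by (simp add: exp_diff)
  qed
  obtain D where "((\<lambda>w. exp (f w)) has_field_derivative D) (at z)"
    using assms(3) z holomorphic_on_open[OF assms(1)] by blast
  then have "((\<lambda>w. exp (f w) / exp (f z)) has_field_derivative D / exp (f z)) (at z)"
    by (rule DERIV_cdivide)
  then have "((\<lambda>w. Ln (exp (f w) / exp (f z))) has_field_derivative
      inverse (exp (f z) / exp (f z)) * (D / exp (f z))) (at z)"
    by (rule DERIV_chain2[rotated]) (rule has_field_derivative_Ln, simp)
  then have "((\<lambda>w. f z + Ln (exp (f w) / exp (f z))) has_field_derivative
      0 + inverse (exp (f z) / exp (f z)) * (D / exp (f z))) (at z)"
    by (intro DERIV_add DERIV_const)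
  then show "\<exists>D. (f has_field_derivative D) (at z)"
    using DERIV_cong_ev[OF refl eq refl] by blast
qed

subsection \<open>Positive exponential sums\<close>

text \<open>Exponents are a function on the index set, since distinct indices may get equal
  exponents when a posynomial is restricted to a complex line.\<close>

definition expsum :: "'a set \<Rightarrow> ('a \<Rightarrow> real) \<Rightarrow> ('a \<Rightarrow> real) \<Rightarrow> complex \<Rightarrow> complex" where
  "expsum A c \<kappa> z = (\<Sum>a\<in>A. of_real (c a) * exp (of_real (\<kappa> a) * z))"

lemma expsum_uminus: "expsum A c (\<lambda>a. - \<kappa> a) z = expsum A c \<kappa> (- z)"
  by (simp add: expsum_def)

lemma expsum_cnj: "expsum A c \<kappa> (cnj z) = cnj (expsum A c \<kappa> z)"
  by (simp add: expsum_def exp_cnj)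

lemma holomorphic_expsum: "expsum A c \<kappa> holomorphic_on S"
  unfolding expsum_def[abs_def] by (intro holomorphic_intros)

lemma has_field_derivative_expsum:
  "(expsum A c \<kappa> has_field_derivative expsum A (\<lambda>a. c a * \<kappa> a) \<kappa> z) (at z within S)"
  unfolding expsum_def[abs_def] by (auto intro!: derivative_eq_intros sum.cong)

lemma norm_expsum_le:
  assumes "\<forall>a\<in>A. 0 \<le> c a" "Re z = u"
  shows "norm (expsum A c \<kappa> z) \<le> Re (expsum A c \<kappa> (of_real u))"
proof -
  have "norm (expsum A c \<kappa> z) \<le> (\<Sum>a\<in>A. norm (of_real (c a) * exp (of_real (\<kappa> a) * z)))"
    unfolding expsum_def by (rule norm_sum)
  also have "\<dots> = (\<Sum>a\<in>A. c a * exp (\<kappa> a * u))"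
    using assms by (intro sum.cong) (auto simp: norm_mult)
  also have "\<dots> = Re (expsum A c \<kappa> (of_real u))"
    unfolding expsum_def Re_sum by (intro sum.cong) (auto simp: Re_exp)
  finally show ?thesis .
qed

lemma expsum_exp_factor:
  "expsum A c (\<lambda>a. \<kappa> a - m) z = exp (- of_real m * z) * expsum A c \<kappa> z"
  unfolding expsum_def sum_distrib_left
  by (intro sum.cong) (auto simp: algebra_simps simp flip: exp_add)

text \<open>As \<open>Re z\<close> tends to -infinity the terms with least exponent dominate; the
  others are bounded in terms of \<open>Re z\<close> alone, so the estimate is uniform in
  \<open>Im z\<close>. It is applied both to the sum and to its derivative.\<close>

lemma expsum_asymptotic:
  assumes "finite A" "\<forall>a\<in>A. m \<le> \<kappa> a" "0 < e"
  shows "\<forall>\<^sub>F u in at_bot. \<forall>z. Re z = u \<longrightarrow>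
    norm (exp (- of_real m * z) * expsum A c \<kappa> z - of_real (\<Sum>a\<in>{a\<in>A. \<kappa> a = m}. c a)) < e"
proof -
  define B where "B = {a\<in>A. \<kappa> a \<noteq> m}"
  have fin: "finite B"
    using assms(1) by (simp add: B_def)
  have "((\<lambda>u. \<Sum>a\<in>B. \<bar>c a\<bar> * exp ((\<kappa> a - m) * u)) \<longlongrightarrow> (\<Sum>a\<in>B. \<bar>c a\<bar> * 0)) at_bot"
  proof (intro tendsto_intros)
    fix a assume "a \<in> B"
    then have "0 < \<kappa> a - m"
      using assms(2) by (force simp: B_def)
    then have "filterlim (\<lambda>u. (\<kappa> a - m) * u) at_bot at_bot"
      by (intro filterlim_tendsto_pos_mult_at_bot[OF tendsto_const _ filterlim_ident])
    then show "((\<lambda>u. exp ((\<kappa> a - m) * u)) \<longlongrightarrow> 0) at_bot"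
      by (rule filterlim_compose[OF exp_at_bot])
  qed
  then have "\<forall>\<^sub>F u in at_bot. (\<Sum>a\<in>B. \<bar>c a\<bar> * exp ((\<kappa> a - m) * u)) < e"
    using assms(3) by (auto intro: order_tendstoD)
  then show ?thesis
  proof eventually_elim
    case (elim u)
    show ?case
    proof (intro allI impI)
      fix z assume z: "Re z = u"
      have AB: "A = {a\<in>A. \<kappa> a = m} \<union> B"
        by (auto simp: B_def)
      have "expsum A c (\<lambda>a. \<kappa> a - m) z = (\<Sum>a\<in>{a\<in>A. \<kappa> a = m}. of_real (c a)) + expsum B c (\<lambda>a. \<kappa> a - m) z"
        unfolding expsum_def by (subst AB, subst sum.union_disjoint)
          (use assms(1) fin in \<open>auto simp: B_def\<close>)
      then have "norm (exp (- of_real m * z) * expsum A c \<kappa> z - of_real (\<Sum>a\<in>{a\<in>A. \<kappa> a = m}. c a))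
          = norm (expsum B c (\<lambda>a. \<kappa> a - m) z)"
        by (simp add: expsum_exp_factor)
      also have "\<dots> \<le> (\<Sum>a\<in>B. norm (of_real (c a) * exp (of_real (\<kappa> a - m) * z)))"
        unfolding expsum_def by (rule norm_sum)
      also have "\<dots> = (\<Sum>a\<in>B. \<bar>c a\<bar> * exp ((\<kappa> a - m) * u))"
        using z by (intro sum.cong) (auto simp: norm_mult)
      finally show "norm (exp (- of_real m * z) * expsum A c \<kappa> z - of_real (\<Sum>a\<in>{a\<in>A. \<kappa> a = m}. c a)) < e"
        using elim by simp
    qed
  qed
qed

text \<open>Multiplied by \<open>exp (- m * z)\<close> and \<open>exp (- m * w)\<close>, both values
  come within \<open>\<delta>\<close> of the same \<open>C > 0\<close>, the total coefficient of the
  least exponent \<open>m\<close>.\<close>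

lemma expsum_ratio:
  assumes "finite A" "A \<noteq> {}" "\<forall>a\<in>A. 0 < c a" "0 < e"
  shows "\<forall>\<^sub>F u in at_bot. \<forall>z w. Re z = u \<longrightarrow> Re w = u \<longrightarrow>
    norm (expsum A c \<kappa> w) \<le> (1 + e) * norm (expsum A c \<kappa> z)"
proof -
  define m where "m = Min (\<kappa> ` A)"
  define C where "C = (\<Sum>a\<in>{a\<in>A. \<kappa> a = m}. c a)"
  have "m \<in> \<kappa> ` A"
    unfolding m_def using assms by (intro Min_in) auto
  then have C: "0 < C"
    unfolding C_def using assms by (intro sum_pos) auto
  have m: "\<forall>a\<in>A. m \<le> \<kappa> a"
    unfolding m_def using assms(1) by simp
  \<comment> \<open>The solution of \<open>C + \<delta> = (1 + e) * (C - \<delta>)\<close>, which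
    compares the largest and the smallest possible modulus.\<close>
  define \<delta> where "\<delta> = C * e / (2 + e)"
  have \<delta>: "0 < \<delta>" "C + \<delta> = (1 + e) * (C - \<delta>)"
    using C assms(4) by (auto simp: \<delta>_def field_simps)
  show ?thesis
    using expsum_asymptotic[where \<kappa> = \<kappa> and c = c, OF assms(1) m \<delta>(1), folded C_def]
  proof eventually_elim
    case (elim u)
    show ?case
    proof (intro allI impI)
      fix z w assume z: "Re z = u" and w: "Re w = u"
      have "exp (- m * u) * norm (expsum A c \<kappa> w) = norm (exp (- of_real m * w) * expsum A c \<kappa> w)"
        using w by (simp add: norm_mult)
      also have "\<dots> \<le> C + \<delta>"
        using elim w C norm_triangle_ineq2[of "exp (- of_real m * w) * expsum A c \<kappa> w" "of_real C"] by force
      also have "\<dots> = (1 + e) * (C - \<delta>)"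
        by (rule \<delta>)
      also have "C - \<delta> \<le> norm (exp (- of_real m * z) * expsum A c \<kappa> z)"
        using elim z C norm_triangle_ineq3[of "exp (- of_real m * z) * expsum A c \<kappa> z" "of_real C"] by force
      also have "\<dots> = exp (- m * u) * norm (expsum A c \<kappa> z)"
        using z by (simp add: norm_mult)
      finally show "norm (expsum A c \<kappa> w) \<le> (1 + e) * norm (expsum A c \<kappa> z)"
        using assms(4) by (simp add: mult.left_commute)
    qed
  qed
qed

text \<open>Up to conjugation, \<open>z - of_real (2 * \<eta>) * \<i>\<close> is the mirror image of
  \<open>z\<close> in the line at height \<open>\<eta>\<close>. It may leave the zero-free strip,
  which is harmless in the numerator of \<open>H\<close>.\<close>

lemma expsum_reflect_le:
  assumes "finite A" "A \<noteq> {}" "\<forall>a\<in>A. 0 < c a"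
    and nz: "\<forall>z. \<bar>Im z\<bar> < pi \<longrightarrow> expsum A c \<kappa> z \<noteq> 0"
    and \<eta>: "\<eta> < pi" and z: "0 \<le> Im z" "Im z \<le> \<eta>"
  shows "norm (expsum A c \<kappa> (z - of_real (2 * \<eta>) * \<i>)) \<le> norm (expsum A c \<kappa> z)"
proof -
  define R where "R = expsum A c \<kappa>"
  define H where "H = (\<lambda>z. R (z - of_real (2 * \<eta>) * \<i>) / R z)"
  have Rnz: "R z \<noteq> 0" if "0 \<le> Im z" "Im z \<le> \<eta>" for z
    unfolding R_def using that \<eta> nz by auto
  have "norm (H z) \<le> 1 + e" if e: "0 < e" for e
  proof -
    obtain M1 where M1: "\<forall>u\<le>M1. \<forall>z w. Re z = u \<longrightarrow> Re w = u \<longrightarrow> norm (R w) \<le> (1 + e) * norm (R z)"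
      using expsum_ratio[where \<kappa> = \<kappa> and c = c, OF assms(1-3) e] unfolding eventually_at_bot_linorder R_def by blast
    obtain M2 where M2: "\<forall>u\<le>M2. \<forall>z w. Re z = u \<longrightarrow> Re w = u \<longrightarrow> norm (R (- w)) \<le> (1 + e) * norm (R (- z))"
      using expsum_ratio[where \<kappa> = "\<lambda>a. - \<kappa> a" and c = c, OF assms(1-3) e]
      unfolding eventually_at_bot_linorder R_def expsum_uminus by blast
    \<comment> \<open>The rectangle contains \<open>z\<close>, and its vertical edges lie where the
      asymptotic bounds hold; the right edge uses the bound for the sum in
      \<open>- z\<close>.\<close>
    define M where "M = max \<bar>Re z\<bar> (max (- M1) (- M2))"
    let ?S = "cbox (Complex (- M) 0) (Complex M \<eta>)"
    show ?thesis
    proof (rule maximum_modulus_frontier[where S = ?S and f = H and \<xi> = z])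
      have "(R \<circ> (\<lambda>z. z - of_real (2 * \<eta>) * \<i>)) holomorphic_on ?S"
        unfolding R_def by (rule holomorphic_on_compose[OF _ holomorphic_expsum]) (intro holomorphic_intros)
      then have hol: "H holomorphic_on ?S"
        unfolding H_def o_def
      proof (rule holomorphic_on_divide)
        show "R holomorphic_on ?S"
          unfolding R_def by (rule holomorphic_expsum)
      qed (use Rnz in \<open>simp add: in_cbox_complex_iff\<close>)
      show "H holomorphic_on interior ?S"
        by (rule holomorphic_on_subset[OF hol interior_subset])
      show "continuous_on (closure ?S) H"
        using holomorphic_on_imp_continuous_on[OF hol] by (simp only: closure_closed closed_cbox)
      show "bounded ?S" by (rule bounded_cbox)
      show "z \<in> ?S"
        using z by (auto simp: in_cbox_complex_iff M_def)
      fix w assume "w \<in> frontier ?S"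
      then have w: "\<bar>Re w\<bar> \<le> M" "0 \<le> Im w" "Im w \<le> \<eta>"
          and "Re w = - M \<or> Re w = M \<or> Im w = 0 \<or> Im w = \<eta>"
        by (auto simp: frontier_cbox in_cbox_complex_iff in_box_complex_iff)
      then consider "Re w = - M" | "Re w = M" | "Im w = 0" | "Im w = \<eta>"
        by blast
      then have "norm (R (w - of_real (2 * \<eta>) * \<i>)) \<le> (1 + e) * norm (R w)"
      proof cases
        case 1
        then show ?thesis
          using M1[rule_format, of "- M" w "w - of_real (2 * \<eta>) * \<i>"] by (simp add: M_def)
      next
        case 2
        then show ?thesis
          using M2[rule_format, of "- M" "- w" "- (w - of_real (2 * \<eta>) * \<i>)"] by (simp add: M_def)
      next
        case 3
        then have "w = of_real (Re w)"
          by (simp add: complex_eq_iff)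
        then have "norm (R (w - of_real (2 * \<eta>) * \<i>)) \<le> Re (R w)"
          using norm_expsum_le[of A c "w - of_real (2 * \<eta>) * \<i>" "Re w" \<kappa>] assms(3)
          unfolding R_def by (simp add: less_imp_le)
        also have "\<dots> \<le> norm (R w)"
          by (rule complex_Re_le_cmod)
        also have "\<dots> \<le> (1 + e) * norm (R w)"
          using e by (simp add: mult_le_cancel_right1)
        finally show ?thesis .
      next
        case 4
        then have "w - of_real (2 * \<eta>) * \<i> = cnj w"
          by (simp add: complex_eq_iff)
        then show ?thesis
          using e by (simp add: R_def expsum_cnj mult_le_cancel_right1)
      qed
      then show "norm (H w) \<le> 1 + e"
        using Rnz[OF w(2,3)] by (simp add: H_def norm_divide pos_divide_le_eq)
    qed
  qed
  then have "norm (H z) \<le> 1"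
    by (rule field_le_epsilon)
  then show ?thesis
    using Rnz[OF z] by (simp add: H_def norm_divide pos_divide_le_eq R_def)
qed

text \<open>Reflection in the line at height \<open>(s + t) / 2\<close>, which is below
  \<open>pi\<close>, exchanges the two points.\<close>

lemma expsum_norm_antimono:
  assumes "finite A" "A \<noteq> {}" "\<forall>a\<in>A. 0 < c a"
    and "\<forall>z. \<bar>Im z\<bar> < pi \<longrightarrow> expsum A c \<kappa> z \<noteq> 0"
    and "0 \<le> s" "s \<le> t" "s + t < 2 * pi"
  shows "norm (expsum A c \<kappa> (Complex u t)) \<le> norm (expsum A c \<kappa> (Complex u s))"
proof -
  have "Complex u s - of_real (2 * ((s + t) / 2)) * \<i> = cnj (Complex u t)"
    by (simp add: complex_eq_iff field_simps)
  then show ?thesis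
    using expsum_reflect_le[where \<kappa> = \<kappa> and c = c and \<eta> = "(s + t) / 2" and z = "Complex u s", OF assms(1-4)] assms(5-7)
    by (simp add: expsum_cnj)
qed

section \<open>The argument of a zero-free exponential sum\<close>

lemma has_vector_derivative_along_line:
  fixes f :: "complex \<Rightarrow> complex"
  assumes "(f has_field_derivative D) (at (a + of_real t * v))"
  shows "((\<lambda>t. f (a + of_real t * v)) has_vector_derivative D * v) (at t)"
proof (rule has_vector_derivative_real_field)
  show "((\<lambda>z. f (a + z * v)) has_field_derivative D * v) (at (of_real t))"
    using assms by (intro DERIV_chain2[where f = f and g = "\<lambda>z. a + z * v"]) (auto intro!: derivative_eq_intros)
qed

text \<open>The Cauchy-Riemann equations, in a form that turns monotonicity of the real part on
  vertical lines into monotonicity of the imaginary part on horizontal ones.\<close>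

lemma
  assumes "(f has_field_derivative D) (at (Complex u t))"
  shows Re_has_derivative_vertical: "((\<lambda>t. Re (f (Complex u t))) has_real_derivative - Im D) (at t)"
    and Im_has_derivative_vertical: "((\<lambda>t. Im (f (Complex u t))) has_real_derivative Re D) (at t)"
    and Re_has_derivative_horizontal: "((\<lambda>u. Re (f (Complex u t))) has_real_derivative Re D) (at u)"
    and Im_has_derivative_horizontal: "((\<lambda>u. Im (f (Complex u t))) has_real_derivative Im D) (at u)"
proof -
  have eq: "Complex u t = of_real u + of_real t * \<i>" "Complex u t = of_real t * \<i> + of_real u * 1" for u t
    by (auto simp: complex_eq_iff)
  have *: "((\<lambda>t. f (Complex u t)) has_vector_derivative D * \<i>) (at t)"
    using has_vector_derivative_along_line[of f D "of_real u" t \<i>] assms by (simp add: eq(1))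
  show "((\<lambda>t. Re (f (Complex u t))) has_real_derivative - Im D) (at t)"
    using bounded_linear.has_vector_derivative[OF bounded_linear_Re *]
    by (simp add: has_real_derivative_iff_has_vector_derivative)
  show "((\<lambda>t. Im (f (Complex u t))) has_real_derivative Re D) (at t)"
    using bounded_linear.has_vector_derivative[OF bounded_linear_Im *]
    by (simp add: has_real_derivative_iff_has_vector_derivative)
  have *: "((\<lambda>u. f (Complex u t)) has_vector_derivative D * 1) (at u)"
    using has_vector_derivative_along_line[of f D "of_real t * \<i>" u 1] assms unfolding eq(2) .
  show "((\<lambda>u. Re (f (Complex u t))) has_real_derivative Re D) (at u)"
    using bounded_linear.has_vector_derivative[OF bounded_linear_Re *]
    by (simp add: has_real_derivative_iff_has_vector_derivative)
  show "((\<lambda>u. Im (f (Complex u t))) has_real_derivative Im D) (at u)"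
    using bounded_linear.has_vector_derivative[OF bounded_linear_Im *]
    by (simp add: has_real_derivative_iff_has_vector_derivative)
qed

text \<open>The logarithmic derivative tends to the least exponent \<open>m \<ge> 0\<close> as
  \<open>Re z\<close> tends to -infinity, uniformly in \<open>Im z\<close>.\<close>

lemma expsum_logderiv_bound:
  assumes "finite A" "A \<noteq> {}" "\<forall>a\<in>A. 0 < c a" "\<forall>a\<in>A. 0 \<le> \<kappa> a" "0 < e"
  shows "\<forall>\<^sub>F u in at_bot. \<forall>z. Re z = u \<longrightarrow>
    - e \<le> Re (expsum A (\<lambda>a. c a * \<kappa> a) \<kappa> z / expsum A c \<kappa> z)"
proof -
  define m where "m = Min (\<kappa> ` A)"
  define C where "C = (\<Sum>a\<in>{a\<in>A. \<kappa> a = m}. c a)"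
  have "m \<in> \<kappa> ` A"
    unfolding m_def using assms by (intro Min_in) auto
  then have C: "0 < C" and m0: "0 \<le> m"
    unfolding C_def using assms by (auto intro!: sum_pos)
  have m: "\<forall>a\<in>A. m \<le> \<kappa> a"
    unfolding m_def using assms(1) by simp
  have Cm: "(\<Sum>a\<in>{a\<in>A. \<kappa> a = m}. c a * \<kappa> a) = C * m"
    unfolding C_def sum_distrib_right by (intro sum.cong) auto
  \<comment> \<open>The first bound keeps \<open>norm Y\<close> at least \<open>C / 2\<close>; the
    second makes \<open>\<delta> * (1 + m)\<close> at most \<open>e * C / 2\<close>.\<close>
  define \<delta> where "\<delta> = min (C / 2) (e * C / (2 * (1 + m)))"
  have \<delta>: "0 < \<delta>" "\<delta> \<le> C / 2" "\<delta> \<le> e * C / (2 * (1 + m))"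
    unfolding \<delta>_def using C m0 assms(5) by (simp_all only: min.cobounded1 min.cobounded2) simp
  show ?thesis
    using expsum_asymptotic[where \<kappa> = \<kappa> and c = c, OF assms(1) m \<delta>(1), folded C_def]
      expsum_asymptotic[where \<kappa> = \<kappa> and c = "\<lambda>a. c a * \<kappa> a", OF assms(1) m \<delta>(1), unfolded Cm]
  proof eventually_elim
    case (elim u)
    show ?case
    proof (intro allI impI)
      fix z assume z: "Re z = u"
      define X where "X = exp (- of_real m * z) * expsum A (\<lambda>a. c a * \<kappa> a) \<kappa> z"
      define Y where "Y = exp (- of_real m * z) * expsum A c \<kappa> z"
      have Y: "norm (Y - of_real C) < \<delta>" and X: "norm (X - of_real (C * m)) < \<delta>"
        using elim z by (auto simp: X_def Y_def)
      have Ylow: "C / 2 \<le> norm Y"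
        using Y \<delta>(2) C norm_triangle_ineq3[of Y "of_real C"] by (simp add: norm_minus_commute)
      then have Y0: "Y \<noteq> 0"
        using C by auto
      have "X - of_real m * Y = (X - of_real (C * m)) - of_real m * (Y - of_real C)"
        by (simp add: algebra_simps)
      then have "norm (X - of_real m * Y) = norm ((X - of_real (C * m)) - of_real m * (Y - of_real C))"
        by (rule arg_cong)
      also have "\<dots> \<le> norm (X - of_real (C * m)) + norm (of_real m * (Y - of_real C))"
        by (rule norm_triangle_ineq4)
      also have "norm (of_real m * (Y - of_real C)) = m * norm (Y - of_real C)"
        using m0 by (simp add: norm_mult)
      also have "norm (X - of_real (C * m)) + m * norm (Y - of_real C) \<le> \<delta> + m * \<delta>"
        using X Y m0 by (intro add_mono mult_left_mono) auto
      also have "\<dots> = \<delta> * (1 + m)"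
        by (simp add: algebra_simps)
      also have "\<dots> \<le> e * (C / 2)"
        using \<delta>(3) m0 by (simp add: pos_le_divide_eq algebra_simps)
      also have "\<dots> \<le> e * norm Y"
        using Ylow assms(5) by (intro mult_left_mono) auto
      finally have "norm ((X - of_real m * Y) / Y) \<le> e"
        using Y0 by (simp add: norm_divide pos_divide_le_eq)
      then have "- e \<le> Re ((X - of_real m * Y) / Y)"
        using abs_Re_le_cmod[of "(X - of_real m * Y) / Y"] by linarith
      also have "(X - of_real m * Y) / Y = X / Y - of_real m"
        using Y0 by (simp add: diff_divide_distrib)
      also have "X / Y = expsum A (\<lambda>a. c a * \<kappa> a) \<kappa> z / expsum A c \<kappa> z"
        by (simp add: X_def Y_def)
      finally show "- e \<le> Re (expsum A (\<lambda>a. c a * \<kappa> a) \<kappa> z / expsum A c \<kappa> z)"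
        using m0 by simp
    qed
  qed
qed

text \<open>Starting on the real axis, go up a vertical line far to the left, where
  \<open>Im L\<close> has slope at least \<open>- e\<close>, then right to \<open>z\<close>, along
  which \<open>Im L\<close> does not decrease. Finally let \<open>e\<close> tend to 0.\<close>

lemma Im_log_expsum_nonneg:
  assumes A: "finite A" "A \<noteq> {}" "\<forall>a\<in>A. 0 < c a" and \<kappa>: "\<forall>a\<in>A. 0 \<le> \<kappa> a"
    and hol: "L holomorphic_on {z. \<bar>Im z\<bar> < pi}"
    and exp_L: "\<And>z. \<bar>Im z\<bar> < pi \<Longrightarrow> exp (L z) = expsum A c \<kappa> z"
    and real_L: "\<And>u. Im (L (of_real u)) = 0"
    and z: "0 \<le> Im z" "Im z < pi"
  shows "0 \<le> Im (L z)"
proof -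
  define D where "D = (\<lambda>z. expsum A (\<lambda>a. c a * \<kappa> a) \<kappa> z / expsum A c \<kappa> z)"
  have nz: "\<forall>z. \<bar>Im z\<bar> < pi \<longrightarrow> expsum A c \<kappa> z \<noteq> 0"
    using exp_L exp_not_eq_zero by metis
  have op: "open {z. \<bar>Im z\<bar> < pi}"
    by (intro open_Collect_less continuous_intros)
  have D: "(L has_field_derivative D z) (at z)" if z: "\<bar>Im z\<bar> < pi" for z
  proof -
    obtain D' where D': "(L has_field_derivative D') (at z)"
      using hol z holomorphic_on_open[OF op] by blast
    have "((\<lambda>z. exp (L z)) has_field_derivative exp (L z) * D') (at z)"
      by (rule DERIV_chain2[OF DERIV_exp D'])
    moreover have "((\<lambda>z. exp (L z)) has_field_derivative expsum A (\<lambda>a. c a * \<kappa> a) \<kappa> z) (at z)"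
    proof (rule has_field_derivative_transform_within_open[OF has_field_derivative_expsum op])
      show "z \<in> {z. \<bar>Im z\<bar> < pi}"
        using z by simp
    qed (simp add: exp_L)
    ultimately have "exp (L z) * D' = expsum A (\<lambda>a. c a * \<kappa> a) \<kappa> z"
      by (rule DERIV_unique)
    then have "D' = D z"
      using nz z by (simp add: D_def exp_L[OF z] field_simps)
    with D' show ?thesis
      by simp
  qed
  \<comment> \<open>\<open>Re L\<close> is the logarithm of the modulus of the sum, so it decreases
    in \<open>t\<close>; its vertical derivative is \<open>- Im D\<close>.\<close>
  have ImD: "0 \<le> Im (D (Complex u t))" if t: "0 < t" "t < pi" for u t
  proof (rule mono_on_imp_deriv_nonneg)
    show "mono_on {0<..<pi} (\<lambda>t. - Re (L (Complex u t)))"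
    proof (rule mono_onI)
      fix r s :: real assume rs: "r \<in> {0<..<pi}" "s \<in> {0<..<pi}" "r \<le> s"
      then have "norm (exp (L (Complex u s))) \<le> norm (exp (L (Complex u r)))"
        using expsum_norm_antimono[where \<kappa> = \<kappa> and c = c and s = r and t = s and u = u, OF A nz] by (simp add: exp_L)
      then show "- Re (L (Complex u r)) \<le> - Re (L (Complex u s))"
        by simp
    qed
    show "((\<lambda>t. - Re (L (Complex u t))) has_real_derivative Im (D (Complex u t))) (at t)"
      using DERIV_minus[OF Re_has_derivative_vertical[OF D]] t by simp
  qed (use t in auto)
  have "0 \<le> Im (L z) + e * Im z" if e: "0 < e" for e
  proof -
    define t where "t = Im z"
    obtain N where N: "\<forall>u\<le>N. \<forall>w. Re w = u \<longrightarrow> - e \<le> Re (D w)"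
      using expsum_logderiv_bound[where \<kappa> = \<kappa> and c = c, OF A \<kappa> e] unfolding eventually_at_bot_linorder D_def by blast
    define u where "u = min N (Re z)"
    have "Im (L (Complex u 0)) + e * 0 \<le> Im (L (Complex u t)) + e * t"
    proof (rule DERIV_nonneg_imp_nondecreasing[where f = "\<lambda>s. Im (L (Complex u s)) + e * s"])
      fix s assume s: "0 \<le> s" "s \<le> t"
      show "\<exists>y. ((\<lambda>s. Im (L (Complex u s)) + e * s) has_real_derivative y) (at s) \<and> 0 \<le> y"
      proof (intro exI conjI)
        show "((\<lambda>s. Im (L (Complex u s)) + e * s) has_real_derivative Re (D (Complex u s)) + e * 1) (at s)"
          using s z by (intro DERIV_add Im_has_derivative_vertical D DERIV_cmult DERIV_ident) (auto simp: t_def)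
        show "0 \<le> Re (D (Complex u s)) + e * 1"
          using N[rule_format, of u "Complex u s"] by (simp add: u_def)
      qed
    qed (use z in \<open>simp add: t_def\<close>)
    moreover have "Im (L (Complex u t)) \<le> Im (L (Complex (Re z) t))"
    \<comment> \<open>\<open>ImD\<close> is available only above the real axis; on the axis
      \<open>Im L\<close> vanishes.\<close>
    proof (cases "t = 0")
      case True
      then show ?thesis
        using real_L[of u] real_L[of "Re z"] by (simp add: Complex_eq)
    next
      case False
      show ?thesis
      proof (rule DERIV_nonneg_imp_nondecreasing[where f = "\<lambda>u. Im (L (Complex u t))"])
        fix x
        show "\<exists>y. ((\<lambda>u. Im (L (Complex u t))) has_real_derivative y) (at x) \<and> 0 \<le> y"
          using False z by (intro exI[of _ "Im (D (Complex x t))"] conjI Im_has_derivative_horizontal D ImD) (auto simp: t_def)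
      qed (simp add: u_def)
    qed
    moreover have "Im (L (Complex u 0)) = 0"
      using real_L[of u] by (simp add: Complex_eq)
    ultimately show ?thesis
      by (simp add: t_def)
  qed
  note * = this
  show ?thesis
  proof (rule field_le_epsilon)
    fix e :: real assume e: "0 < e"
    have "e / (Im z + 1) * Im z \<le> e"
      using e z by (simp add: pos_divide_le_eq)
    then show "0 \<le> Im (L z) + e"
      using *[of "e / (Im z + 1)"] e z by (smt (verit) divide_pos_pos)
  qed
qed

subsection \<open>The logarithm of a stable posynomial\<close>

definition posy_exp :: "(real ^ 'n) set \<Rightarrow> (real ^ 'n \<Rightarrow> real) \<Rightarrow> complex ^ 'n \<Rightarrow> complex" where
  "posy_exp A c w = (\<Sum>a\<in>A. of_real (c a) * exp (\<Sum>i\<in>UNIV. of_real (a $ i) * w $ i))"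

text \<open>Up to a common imaginary shift, the logarithms of points with all coordinates in the
  right half-plane. Convexity makes this set contractible, for the existence of a logarithm, and
  connected, for its uniqueness.\<close>

definition tube :: "(complex ^ 'n) set" where
  "tube = {w. \<forall>i j. \<bar>Im (w $ i) - Im (w $ j)\<bar> < pi}"

lemma tubeI: "(\<And>i j. \<bar>Im (w $ i) - Im (w $ j)\<bar> < pi) \<Longrightarrow> w \<in> tube"
  by (simp add: tube_def)

lemma tube_shift_iff: "(\<chi> i. w $ i + t) \<in> tube \<longleftrightarrow> w \<in> tube"
  by (simp add: tube_def)

lemma tube_cnj: "w \<in> tube \<Longrightarrow> (\<chi> i. cnj (w $ i)) \<in> tube"
  by (simp add: tube_def abs_minus_commute)

lemma tube_of_real: "(\<chi> i. of_real (u i)) \<in> tube"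
  by (simp add: tube_def)

lemma convex_tube: "convex (tube :: (complex ^ 'n) set)"
proof (rule convexI)
  fix v w :: "complex ^ 'n" and s t :: real
  assume *: "v \<in> tube" "w \<in> tube" "0 \<le> s" "0 \<le> t" "s + t = 1"
  show "s *\<^sub>R v + t *\<^sub>R w \<in> tube"
  proof (rule tubeI)
    fix i j
    have "Im ((s *\<^sub>R v + t *\<^sub>R w) $ i) - Im ((s *\<^sub>R v + t *\<^sub>R w) $ j)
        = s * (Im (v $ i) - Im (v $ j)) + t * (Im (w $ i) - Im (w $ j))"
      by (simp add: algebra_simps)
    also have "\<bar>\<dots>\<bar> \<le> \<bar>s * (Im (v $ i) - Im (v $ j))\<bar> + \<bar>t * (Im (w $ i) - Im (w $ j))\<bar>"
      by (rule abs_triangle_ineq)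
    also have "\<dots> = s * \<bar>Im (v $ i) - Im (v $ j)\<bar> + t * \<bar>Im (w $ i) - Im (w $ j)\<bar>"
      using *(3,4) by (simp add: abs_mult)
    also have "\<dots> < pi"
      using * by (intro convex_bound_lt) (auto simp: tube_def)
    finally show "\<bar>Im ((s *\<^sub>R v + t *\<^sub>R w) $ i) - Im ((s *\<^sub>R v + t *\<^sub>R w) $ j)\<bar> < pi" .
  qed
qed

lemma continuous_on_posy_exp: "continuous_on S (posy_exp A c)"
  unfolding posy_exp_def[abs_def] by (intro continuous_intros)

lemma posy_exp_cnj: "posy_exp A c (\<chi> i. cnj (w $ i)) = cnj (posy_exp A c w)"
  by (simp add: posy_exp_def exp_cnj)

lemma posy_exp_shift:
  assumes "homogeneous_of_degree A d"
  shows "posy_exp A c (\<chi> i. w $ i + t) = exp (of_real d * t) * posy_exp A c w"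
proof -
  have "(\<Sum>i\<in>UNIV. of_real (a $ i) * (w $ i + t)) = of_real d * t + (\<Sum>i\<in>UNIV. of_real (a $ i) * w $ i)"
    if "a \<in> A" for a
  proof -
    have "of_real d = (\<Sum>i\<in>UNIV. complex_of_real (a $ i))"
      using assms that by (simp add: homogeneous_of_degree_def flip: of_real_sum)
    then show ?thesis
      by (simp add: algebra_simps sum.distrib sum_distrib_left)
  qed
  then show ?thesis
    by (simp add: posy_exp_def exp_add sum_distrib_left algebra_simps)
qed

lemma posy_exp_of_real:
  "posy_exp A c (\<chi> i. of_real (u $ i)) = of_real (posy A c (\<chi> i. exp (u $ i)))"
proof -
  have "(\<Sum>i\<in>UNIV. complex_of_real (a $ i) * of_real (u $ i)) = of_real (\<Sum>i\<in>UNIV. a $ i * u $ i)" for a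
    by simp
  then show ?thesis
    unfolding posy_exp_def posy_def by (simp add: powr_def exp_sum flip: exp_of_real)
qed

lemma posy_pos:
  assumes "posynomial A c" "A \<noteq> {}" "\<And>i. 0 < x $ i"
  shows "0 < posy A c x"
proof -
  have "0 < x $ i powr a $ i" for a i
    using assms(3)[of i] by simp
  then show ?thesis
    unfolding posy_def using assms(1,2)
    by (intro sum_pos mult_pos_pos prod_pos) (auto simp: posynomial_def)
qed

text \<open>Subtracting the midpoint \<open>m\<close> of the range of imaginary parts brings all of
  them into \<open>(- pi / 2, pi / 2)\<close>, where stability applies; by homogeneity this changes
  the value only by a nonzero factor.\<close>

lemma posy_exp_nonzero:
  assumes hom: "homogeneous_of_degree A d" and stab: "sector_stable 1 A c" and w: "w \<in> tube"
  shows "posy_exp A c w \<noteq> 0"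
proof -
  define I where "I = range (\<lambda>i. Im (w $ i))"
  define m where "m = (Max I + Min I) / 2"
  have fin: "finite I" "I \<noteq> {}"
    by (auto simp: I_def)
  obtain i j where ij: "Max I = Im (w $ i)" "Min I = Im (w $ j)"
    using Max_in[OF fin] Min_in[OF fin] unfolding I_def by blast
  have lt: "Max I - Min I < pi"
    using w[unfolded tube_def mem_Collect_eq, rule_format, of i j] unfolding ij by linarith
  define v where "v = (\<chi> i. w $ i + (- of_real m * \<i>))"
  have v: "\<bar>Im (v $ k)\<bar> < pi / 2" for k
  proof -
    have "Im (w $ k) \<le> Max I" "Min I \<le> Im (w $ k)"
      using fin by (auto simp: I_def intro!: Max_ge Min_le)
    then show ?thesis
      using lt by (auto simp: v_def m_def abs_if field_simps)
  qed
  have Ln_v: "Ln (exp (v $ k)) = v $ k" for k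
    using v[of k] pi_gt_zero by (intro Ln_exp) linarith+
  have "posy_exp A c v = posy_complex A c (\<chi> i. exp (v $ i))"
    unfolding posy_exp_def posy_complex_def by (simp add: powr_def Ln_v exp_sum)
  moreover have "posy_complex A c (\<chi> i. exp (v $ i)) \<noteq> 0"
  proof -
    have "exp (v $ k) \<in> sector 1" for k
      using v[of k] cos_gt_zero_pi[of "Im (v $ k)"] by (auto simp: sector_1 Re_exp)
    then show ?thesis
      using stab by (simp add: sector_stable_def)
  qed
  ultimately show ?thesis
    using posy_exp_shift[OF hom, of c w "- of_real m * \<i>"] by (auto simp: v_def)
qed

lemma stable_nonempty: "sector_stable 1 A c \<Longrightarrow> A \<noteq> {}"
  by (auto simp: sector_stable_def sector_1 posy_complex_def dest: spec[of _ "\<chi> i. 1"])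

text \<open>The existence of \<open>G\<close> carries the stability hypothesis. Only continuity of
  \<open>G\<close> is assumed; holomorphy is recovered for one-variable restrictions by
  \<open>continuous_log_holomorphic\<close>. \<open>G_0\<close> fixes the branch.\<close>

locale homogeneous_posy_log =
  fixes A :: "(real ^ 'n) set" and c :: "real ^ 'n \<Rightarrow> real" and d :: real
    and G :: "complex ^ 'n \<Rightarrow> complex"
  assumes posy: "posynomial A c" and nonempty: "A \<noteq> {}"
    and hom: "homogeneous_of_degree A d" and d: "0 < d"
    and cont_G: "continuous_on tube G"
    and exp_G: "w \<in> tube \<Longrightarrow> exp (G w) = posy_exp A c w"
    and G_0: "Im (G 0) = 0"

lemma homogeneous_posy_log_exists:
  fixes A :: "(real ^ 'n) set"
  assumes "posynomial A c" "homogeneous_of_degree A d" "0 < d" "sector_stable 1 A c"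
  obtains G where "homogeneous_posy_log A c d G"
proof -
  have 0: "0 \<in> (tube :: (complex ^ 'n) set)"
    by (simp add: tube_def)
  obtain g where g: "continuous_on tube g" "\<And>w. w \<in> tube \<Longrightarrow> posy_exp A c w = exp (g w)"
    using continuous_logarithm_on_contractible[OF continuous_on_posy_exp convex_imp_contractible[OF convex_tube]]
      posy_exp_nonzero[OF assms(2,4)] by metis
  define x where "x = posy A c (\<chi> i. exp ((0 :: real ^ 'n) $ i))"
  have x: "0 < x"
    unfolding x_def using posy_pos[OF assms(1) stable_nonempty[OF assms(4)]] by simp
  have "(\<chi> i. complex_of_real ((0 :: real ^ 'n) $ i)) = 0"
    by (simp add: vec_eq_iff)
  then have "exp (g 0) = of_real x"
    using g(2)[OF 0] posy_exp_of_real[of A c 0] by (simp add: x_def)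
  \<comment> \<open>Since \<open>exp (g 0) = x\<close>, this changes \<open>g\<close> by a multiple
    of \<open>2 * pi * \<i>\<close> and makes the value at 0 real.\<close>
  then have "homogeneous_posy_log A c d (\<lambda>w. g w - g 0 + of_real (ln x))"
    using assms g x stable_nonempty[OF assms(4)]
    by unfold_locales (auto intro!: continuous_intros simp: exp_add exp_diff exp_of_real)
  then show thesis ..
qed

section \<open>Symmetries of the logarithm and the range of its imaginary part\<close>

context homogeneous_posy_log
begin

lemma G_of_real: "G (\<chi> i. of_real (u $ i)) = of_real (ln (posy A c (\<chi> i. exp (u $ i))))"
proof (rule continuous_log_unique[where S = UNIV and a = 0 and z = u
    and f = "\<lambda>u. G (\<chi> i. of_real (u $ i))" and g = "\<lambda>u. of_real (ln (posy A c (\<chi> i. exp (u $ i))))"])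
  have pos: "0 < posy A c (\<chi> i. exp (u $ i))" for u
    using posy_pos[OF posy nonempty] by simp
  show "continuous_on UNIV (\<lambda>u :: real ^ 'n. G (\<chi> i. of_real (u $ i)))"
    by (intro continuous_on_compose2[OF cont_G] continuous_intros) (auto simp: tube_of_real)
  have "continuous_on UNIV (\<lambda>u. complex_of_real (posy A c (\<chi> i. exp (u $ i))))"
    unfolding posy_exp_of_real[symmetric]
    by (intro continuous_on_compose2[OF continuous_on_posy_exp[where S = UNIV]] continuous_intros subset_UNIV)
  then have "continuous_on UNIV (\<lambda>u. posy A c (\<chi> i. exp (u $ i)))"
    using continuous_on_Re by fastforce
  then show "continuous_on UNIV (\<lambda>u. complex_of_real (ln (posy A c (\<chi> i. exp (u $ i)))))"
    using pos by (intro continuous_intros) (auto simp: less_imp_neq[symmetric])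
  show "exp (G (\<chi> i. of_real (u $ i))) = exp (complex_of_real (ln (posy A c (\<chi> i. exp (u $ i)))))" for u
    using pos[of u] by (simp add: exp_G[OF tube_of_real] posy_exp_of_real exp_of_real)
  have *: "(\<chi> i. complex_of_real ((0 :: real ^ 'n) $ i)) = 0"
    by (simp add: vec_eq_iff)
  have "exp (G 0) = of_real (posy A c (\<chi> i. exp ((0 :: real ^ 'n) $ i)))"
    using exp_G[of 0] posy_exp_of_real[of A c 0, unfolded *] by (simp add: tube_def)
  moreover have G0: "G 0 = of_real (Re (G 0))"
    using G_0 by (simp add: complex_eq_iff)
  ultimately have "exp (Re (G 0)) = posy A c (\<chi> i. exp ((0 :: real ^ 'n) $ i))"
    by (metis exp_of_real of_real_eq_iff)
  then show "G (\<chi> i. of_real ((0 :: real ^ 'n) $ i)) = of_real (ln (posy A c (\<chi> i. exp ((0 :: real ^ 'n) $ i))))"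
    using G0 by (metis * ln_exp)
qed auto

lemma G_cnj:
  assumes "w \<in> tube"
  shows "G (\<chi> i. cnj (w $ i)) = cnj (G w)"
proof (rule continuous_log_unique[OF convex_connected[OF convex_tube], where a = 0])
  show "continuous_on tube (\<lambda>w. G (\<chi> i. cnj (w $ i)))"
    by (intro continuous_on_compose2[OF cont_G] continuous_intros) (auto simp: tube_cnj)
  show "continuous_on tube (\<lambda>w. cnj (G w))"
    by (intro continuous_intros cont_G)
  show "exp (G (\<chi> i. cnj (w $ i))) = exp (cnj (G w))" if "w \<in> tube" for w
    using that by (simp add: exp_G tube_cnj posy_exp_cnj flip: exp_cnj)
  have "(\<chi> i. cnj ((0 :: complex ^ 'n) $ i)) = 0"
    by (simp add: vec_eq_iff)
  then show "G (\<chi> i. cnj (0 $ i)) = cnj (G 0)"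
    using G_0 by (simp add: complex_eq_iff)
qed (use assms in \<open>auto simp: tube_def\<close>)

text \<open>The tube is invariant under common translations, so both sides are logarithms of the
  same function of \<open>t\<close> on the whole plane, equal at \<open>t = 0\<close>.\<close>

lemma G_shift:
  assumes "w \<in> tube"
  shows "G (\<chi> i. w $ i + t) = G w + of_real d * t"
proof (rule continuous_log_unique[where S = UNIV and a = 0 and z = t
    and f = "\<lambda>t. G (\<chi> i. w $ i + t)" and g = "\<lambda>t. G w + of_real d * t"])
  show "continuous_on UNIV (\<lambda>t. G (\<chi> i. w $ i + t))"
    using assms by (intro continuous_on_compose2[OF cont_G] continuous_intros) (auto simp: tube_shift_iff)
  show "exp (G (\<chi> i. w $ i + t)) = exp (G w + of_real d * t)" for t
    using assms by (simp add: exp_G tube_shift_iff posy_exp_shift[OF hom] exp_add)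
qed (auto intro!: continuous_intros)

text \<open>The point \<open>w\<close> is \<open>l (s * \<i>)\<close> on a complex line with real
  base point and real direction \<open>v\<close>. The entries of \<open>v\<close> lie in [0, 1],
  which keeps \<open>l z\<close> in the tube for \<open>\<bar>Im z\<bar> < pi\<close> and makes the
  exponents \<open>\<kappa>\<close> nonnegative.\<close>

lemma Im_G_nonneg:
  assumes w: "\<And>i. 0 \<le> Im (w $ i)" "\<And>i. Im (w $ i) < pi"
  shows "0 \<le> Im (G w)"
proof -
  define I where "I = range (\<lambda>i. Im (w $ i))"
  define s where "s = Max I"
  have "finite I" "I \<noteq> {}"
    by (auto simp: I_def)
  then have "s \<in> I" and s: "Im (w $ i) \<le> s" for i
    unfolding s_def by (auto simp: I_def)
  then have s': "0 \<le> s" "s < pi"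
    using w by (auto simp: I_def)
  \<comment> \<open>If \<open>s = 0\<close>, all imaginary parts vanish and division by zero gives
    \<open>v i = 0\<close>, so \<open>v i * s = Im (w $ i)\<close> still holds.\<close>
  define v where "v = (\<lambda>i. Im (w $ i) / s)"
  have v: "0 \<le> v i" "v i \<le> 1" "v i * s = Im (w $ i)" for i
    using s[of i] s' w(1)[of i] by (auto simp: v_def divide_le_eq_1)
  define l where "l = (\<lambda>z :: complex. \<chi> i. of_real (Re (w $ i)) + z * of_real (v i))"
  define c' where "c' = (\<lambda>a. c a * exp (\<Sum>i\<in>UNIV. a $ i * Re (w $ i)))"
  define \<kappa> where "\<kappa> = (\<lambda>a :: real ^ 'n. \<Sum>i\<in>UNIV. a $ i * v i)"
  have l_tube: "l z \<in> tube" if "\<bar>Im z\<bar> < pi" for z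
  proof (rule tubeI)
    fix i j
    have "\<bar>Im (l z $ i) - Im (l z $ j)\<bar> = \<bar>Im z\<bar> * \<bar>v i - v j\<bar>"
      by (simp add: l_def abs_mult flip: right_diff_distrib)
    also have "\<dots> \<le> \<bar>Im z\<bar> * 1"
      using v[of i] v[of j] by (intro mult_left_mono) auto
    finally show "\<bar>Im (l z $ i) - Im (l z $ j)\<bar> < pi"
      using that by simp
  qed
  have exp_Gl: "exp (G (l z)) = expsum A c' \<kappa> z" if "\<bar>Im z\<bar> < pi" for z
  proof -
    have "(\<Sum>i\<in>UNIV. of_real (a $ i) * l z $ i)
        = of_real (\<Sum>i\<in>UNIV. a $ i * Re (w $ i)) + of_real (\<kappa> a) * z" for a :: "real ^ 'n"
      by (simp add: l_def \<kappa>_def algebra_simps sum.distrib sum_distrib_left)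
    then show ?thesis
      unfolding exp_G[OF l_tube[OF that]] posy_exp_def expsum_def c'_def
      by (simp add: exp_add mult.assoc flip: exp_of_real)
  qed
  have op: "open {z. \<bar>Im z\<bar> < pi}"
    by (intro open_Collect_less continuous_intros)
  have "0 \<le> Im (G (l (of_real s * \<i>)))"
  proof (rule Im_log_expsum_nonneg[where A = A and c = c' and \<kappa> = \<kappa> and L = "\<lambda>z. G (l z)"])
    show "finite A" "\<forall>a\<in>A. 0 < c' a"
      using posy by (auto simp: posynomial_def c'_def)
    show "\<forall>a\<in>A. 0 \<le> \<kappa> a"
      using posy v by (auto simp: posynomial_def \<kappa>_def intro!: sum_nonneg)
    show "(\<lambda>z. G (l z)) holomorphic_on {z. \<bar>Im z\<bar> < pi}"
    proof (rule continuous_log_holomorphic[OF op])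
      show "continuous_on {z. \<bar>Im z\<bar> < pi} (\<lambda>z. G (l z))"
        unfolding l_def using l_tube
        by (intro continuous_on_compose2[OF cont_G] continuous_intros) (auto simp: l_def)
      show "(\<lambda>z. exp (G (l z))) holomorphic_on {z. \<bar>Im z\<bar> < pi}"
        using holomorphic_expsum by (rule holomorphic_transform) (simp add: exp_Gl)
    qed
    show "Im (G (l (of_real u))) = 0" for u
    proof -
      have "l (of_real u) = (\<chi> i. of_real ((\<chi> i. Re (w $ i) + u * v i) $ i))"
        by (simp add: l_def vec_eq_iff)
      then show ?thesis
        by (simp only: G_of_real Im_complex_of_real)
    qed
  qed (use nonempty exp_Gl s' in auto)
  moreover have "l (of_real s * \<i>) = w"
    using v by (simp add: l_def vec_eq_iff complex_eq_iff mult.commute)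
  ultimately show ?thesis
    by simp
qed

text \<open>Conjugation followed by a shift up by the largest imaginary part \<open>s\<close> gives
  a point to which \<open>Im_G_nonneg\<close> applies; there \<open>G\<close> has imaginary part
  \<open>d * s - Im (G w)\<close>.\<close>

lemma Im_G_le:
  assumes w: "\<And>i. 0 \<le> Im (w $ i)" "\<And>i. Im (w $ i) < pi"
  shows "Im (G w) \<le> d * pi"
proof -
  define I where "I = range (\<lambda>i. Im (w $ i))"
  define s where "s = Max I"
  have "finite I" "I \<noteq> {}"
    by (auto simp: I_def)
  then have "s \<in> I" and s: "Im (w $ i) \<le> s" for i
    unfolding s_def by (auto simp: I_def)
  then have s': "0 \<le> s" "s < pi"
    using w by (auto simp: I_def)
  have wt: "w \<in> tube"
    using w by (intro tubeI) (smt (verit))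
  have "0 \<le> Im (G (\<chi> i. (\<chi> i. cnj (w $ i)) $ i + of_real s * \<i>))"
  proof (rule Im_G_nonneg)
    fix i
    show "0 \<le> Im ((\<chi> i. (\<chi> i. cnj (w $ i)) $ i + of_real s * \<i>) $ i)"
      using s by simp
    show "Im ((\<chi> i. (\<chi> i. cnj (w $ i)) $ i + of_real s * \<i>) $ i) < pi"
      using s' w(1)[of i] by simp
  qed
  also have "\<dots> = d * s - Im (G w)"
    by (simp only: G_shift[OF tube_cnj[OF wt]] G_cnj[OF wt]) simp
  finally have "Im (G w) \<le> d * s"
    by simp
  also have "\<dots> \<le> d * pi"
    using s' d by (intro mult_left_mono) auto
  finally show ?thesis .
qed

subsection \<open>Superadditivity of the root\<close>

definition Ln_line :: "real ^ 'n \<Rightarrow> real ^ 'n \<Rightarrow> complex \<Rightarrow> complex ^ 'n" where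
  "Ln_line x y s = (\<chi> i. Ln (of_real (x $ i) + s * of_real (y $ i)))"

text \<open>A branch of \<open>p (x + s * y) powr (1 / d)\<close>. It is formed from
  \<open>G\<close> because the principal power of \<open>p\<close> could jump where \<open>p\<close>
  crosses the negative axis.\<close>

definition root_line :: "real ^ 'n \<Rightarrow> real ^ 'n \<Rightarrow> complex \<Rightarrow> complex" where
  "root_line x y s = exp (G (Ln_line x y s) / of_real d)"

text \<open>For positive \<open>y\<close>, the plane cut along the real half-line up to the largest
  \<open>- x $ i / y $ i\<close>.\<close>

definition line_domain :: "real ^ 'n \<Rightarrow> real ^ 'n \<Rightarrow> complex set" where
  "line_domain x y = {s. \<forall>i. of_real (x $ i) + s * of_real (y $ i) \<notin> \<real>\<^sub>\<le>\<^sub>0}"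

lemma open_line_domain: "open (line_domain x y)"
proof -
  have "open ((\<lambda>s :: complex. of_real (x $ i) + s * of_real (y $ i)) -` (- \<real>\<^sub>\<le>\<^sub>0))" for i
    by (intro open_vimage open_Compl closed_nonpos_Reals_complex continuous_intros)
  then have "open (\<Inter>i\<in>UNIV. (\<lambda>s :: complex. of_real (x $ i) + s * of_real (y $ i)) -` (- \<real>\<^sub>\<le>\<^sub>0))"
    by (intro open_INT) auto
  also have "(\<Inter>i\<in>UNIV. (\<lambda>s :: complex. of_real (x $ i) + s * of_real (y $ i)) -` (- \<real>\<^sub>\<le>\<^sub>0)) = line_domain x y"
    by (auto simp: line_domain_def)
  finally show ?thesis .
qed

lemma in_line_domain:
  assumes "\<And>i. 0 < y $ i" "Im s \<noteq> 0"
  shows "s \<in> line_domain x y"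
proof -
  have "y $ i \<noteq> 0" for i
    using assms(1)[of i] by simp
  then show ?thesis
    using assms(2) by (auto simp: line_domain_def complex_nonpos_Reals_iff)
qed

lemma of_real_in_line_domain:
  assumes "\<And>i. 0 < x $ i" "\<And>i. 0 < y $ i" "0 \<le> t"
  shows "of_real t \<in> line_domain x y"
proof -
  have "0 < x $ i + t * y $ i" for i
    using assms(1)[of i] assms(2)[of i] assms(3) by (intro add_pos_nonneg) auto
  then show ?thesis
    by (auto simp: line_domain_def complex_nonpos_Reals_iff not_le)
qed

lemma Ln_line_Im_pos:
  assumes "\<And>i. 0 < y $ i" "0 < Im s"
  shows "0 < Im (Ln_line x y s $ i)" "Im (Ln_line x y s $ i) < pi"
proof -
  have Im: "0 < Im (of_real (x $ i) + s * of_real (y $ i))"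
    using assms by simp
  then have "of_real (x $ i) + s * of_real (y $ i) \<noteq> 0"
    by (metis less_irrefl zero_complex.sel(2))
  then show "0 < Im (Ln_line x y s $ i)" "Im (Ln_line x y s $ i) < pi"
    using Im_Ln_pos_lt Im unfolding Ln_line_def vec_lambda_beta by blast+
qed

lemma Ln_line_cnj:
  assumes "s \<in> line_domain x y"
  shows "Ln_line x y (cnj s) = (\<chi> i. cnj (Ln_line x y s $ i))"
  using assms by (auto simp: Ln_line_def line_domain_def vec_eq_iff cnj_Ln)

lemma Ln_line_of_real:
  assumes "\<And>i. 0 < x $ i + t * y $ i"
  shows "Ln_line x y (of_real t) = (\<chi> i. of_real ((\<chi> i. ln (x $ i + t * y $ i)) $ i))"
  using assms by (simp add: Ln_line_def vec_eq_iff flip: Ln_of_real of_real_mult of_real_add)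

text \<open>For \<open>s\<close> in the upper half-plane all arguments lie in
  \<open>(0, pi)\<close>, so they differ by less than \<open>pi\<close>; the lower half-plane
  follows by conjugation, and real \<open>s\<close> gives real logarithms.\<close>

lemma Ln_line_tube:
  assumes "\<And>i. 0 < y $ i" "s \<in> line_domain x y"
  shows "Ln_line x y s \<in> tube"
proof -
  have up: "Ln_line x y s \<in> tube" if "0 < Im s" for s
    using Ln_line_Im_pos[of y s x] assms(1) that by (intro tubeI) (smt (verit))
  consider "0 < Im s" | "Im s < 0" | "Im s = 0"
    by linarith
  then show ?thesis
  proof cases
    case 1
    then show ?thesis by (rule up)
  next
    case 2
    then have "Ln_line x y (cnj s) \<in> tube" "cnj s \<in> line_domain x y"
      using assms(1) by (auto intro: up in_line_domain)
    then show ?thesis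
      using tube_cnj Ln_line_cnj[of "cnj s" x y] by force
  next
    case 3
    then have s: "s = of_real (Re s)"
      by (simp add: complex_eq_iff)
    have "0 < x $ i + Re s * y $ i" for i
      using assms(2) 3 by (auto simp: line_domain_def complex_nonpos_Reals_iff not_le)
    then show ?thesis
      using Ln_line_of_real[of x "Re s" y] s tube_of_real by metis
  qed
qed

lemma holomorphic_root_line:
  assumes "\<And>i. 0 < y $ i"
  shows "root_line x y holomorphic_on line_domain x y"
proof -
  have "(\<lambda>s. G (Ln_line x y s)) holomorphic_on line_domain x y"
  proof (rule continuous_log_holomorphic[OF open_line_domain])
    show "continuous_on (line_domain x y) (\<lambda>s. G (Ln_line x y s))"
      using Ln_line_tube[OF assms]
      by (intro continuous_on_compose2[OF cont_G])
        (auto simp: Ln_line_def line_domain_def intro!: continuous_intros)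
    have "(\<lambda>s. posy_exp A c (Ln_line x y s)) holomorphic_on line_domain x y"
      unfolding posy_exp_def Ln_line_def vec_lambda_beta
      by (intro holomorphic_intros) (auto simp: line_domain_def)
    then show "(\<lambda>s. exp (G (Ln_line x y s))) holomorphic_on line_domain x y"
      by (rule holomorphic_transform) (simp add: exp_G Ln_line_tube assms)
  qed
  then show ?thesis
    unfolding root_line_def[abs_def] using d by (intro holomorphic_intros) auto
qed

lemma root_line_of_real:
  assumes "\<And>i. 0 < x $ i" "\<And>i. 0 < y $ i" "0 \<le> t"
  shows "root_line x y (of_real t) = of_real (posy A c (x + t *\<^sub>R y) powr (1 / d))"
proof -
  have pos: "0 < x $ i + t * y $ i" for i
    using assms(1)[of i] assms(2)[of i] assms(3) by (intro add_pos_nonneg) auto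
  then have *: "(\<chi> i. exp ((\<chi> i. ln (x $ i + t * y $ i)) $ i)) = x + t *\<^sub>R y"
    by (simp add: vec_eq_iff)
  have "0 < posy A c (x + t *\<^sub>R y)"
    using posy_pos[OF posy nonempty] pos by simp
  then show ?thesis
    unfolding root_line_def Ln_line_of_real[OF pos] G_of_real *
    by (simp add: powr_def flip: exp_of_real)
qed

lemma Im_root_line_nonneg:
  assumes "\<And>i. 0 < y $ i" "0 < Im s"
  shows "0 \<le> Im (root_line x y s)"
proof -
  have "0 \<le> Im (G (Ln_line x y s))" "Im (G (Ln_line x y s)) \<le> d * pi"
    using Ln_line_Im_pos[OF assms, of x] by (simp_all add: Im_G_nonneg Im_G_le less_imp_le)
  then show ?thesis
    using d by (auto simp: root_line_def Im_exp pos_divide_le_eq mult.commute intro!: mult_nonneg_nonneg sin_ge_zero)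
qed

text \<open>This is \<open>x + s * y = s * (y + x / s)\<close> with homogeneity of degree 1. The
  branches match because the arguments of \<open>y $ i + x $ i / s\<close> and \<open>s\<close> lie
  in \<open>(- pi, 0)\<close> and \<open>(0, pi)\<close>, so their logarithms add without a
  jump.\<close>

lemma root_line_inverse:
  assumes "\<And>i. 0 < x $ i" "\<And>i. 0 < y $ i" "0 < Im s"
  shows "root_line x y s = s * root_line y x (1 / s)"
proof -
  have s0: "s \<noteq> 0"
    using assms(3) by auto
  have Im_inv: "Im (1 / s) < 0"
    using assms(3) s0 by (simp add: Im_divide divide_neg_pos sum_power2_gt_zero_iff complex_eq_iff)
  have t: "1 / s \<in> line_domain y x"
    using Im_inv assms(1) by (intro in_line_domain) auto
  have "Ln (of_real (x $ i) + s * of_real (y $ i)) = Ln (of_real (y $ i) + 1 / s * of_real (x $ i)) + Ln s" for i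
  proof -
    define v where "v = of_real (y $ i) + 1 / s * of_real (x $ i)"
    have v: "v \<notin> \<real>\<^sub>\<le>\<^sub>0"
      using t by (simp add: line_domain_def v_def)
    then have v0: "v \<noteq> 0"
      by auto
    have "Im v < 0"
      using mult_neg_pos[OF Im_inv assms(1)[of i]] unfolding v_def plus_complex.sel times_complex.sel by simp
    then have "Im (Ln v) < 0" "- pi < Im (Ln v)"
      using Im_Ln_pos_le[OF v0] mpi_less_Im_Ln[OF v0] Im_Ln_le_pi[OF v0] by auto
    moreover have "0 < Im (Ln s)" "Im (Ln s) < pi"
      using Im_Ln_pos_lt[OF s0] assms(3) by auto
    ultimately have "Ln (v * s) = Ln v + Ln s"
      using v0 s0 by (intro Ln_times_simple) auto
    moreover have "v * s = of_real (x $ i) + s * of_real (y $ i)"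
      using s0 by (simp add: v_def field_simps)
    ultimately show ?thesis
      by (simp add: v_def)
  qed
  then have "Ln_line x y s = (\<chi> i. Ln_line y x (1 / s) $ i + Ln s)"
    by (simp add: Ln_line_def vec_eq_iff)
  then have "G (Ln_line x y s) = G (Ln_line y x (1 / s)) + of_real d * Ln s"
    using G_shift[OF Ln_line_tube[OF assms(1) t]] by simp
  then show ?thesis
    using d s0 by (simp add: root_line_def add_divide_distrib exp_add mult.commute)
qed

text \<open>By inversion the difference is the quotient \<open>(F (1 / s) - F 0) / (1 / s)\<close>,
  which tends to the derivative of \<open>F\<close> at 0. That derivative is real, as
  \<open>F\<close> is real on the nonnegative reals.\<close>

lemma root_line_at_infinity:
  assumes x: "\<And>i. 0 < x $ i" and y: "\<And>i. 0 < y $ i" and e: "0 < e"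
  obtains R where "0 < R" "\<And>s. R \<le> norm s \<Longrightarrow> 0 < Im s \<Longrightarrow>
    \<bar>Im (root_line x y s - s * of_real (posy A c y powr (1 / d)))\<bar> < e"
proof -
  define F where "F = root_line y x"
  have F0: "F 0 = of_real (posy A c y powr (1 / d))"
    using root_line_of_real[OF y x, of 0] by (simp add: F_def)
  have "0 \<in> line_domain y x"
    using of_real_in_line_domain[OF y x, of 0] by simp
  then obtain D where D: "(F has_field_derivative D) (at 0)"
    using holomorphic_root_line[OF x] holomorphic_on_open[OF open_line_domain] unfolding F_def by blast
  then have lim: "((\<lambda>s. (F s - F 0) / s) \<longlongrightarrow> D) (at 0)"
    by (simp add: has_field_derivative_iff)
  \<comment> \<open>Along this sequence of positive reals the difference quotients are real, which
    gives \<open>Im D = 0\<close>.\<close>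
  have inverse_lim: "filterlim (\<lambda>n. complex_of_real (inverse (real (Suc n)))) (at 0) sequentially"
    using tendsto_of_real[OF LIMSEQ_inverse_real_of_nat, where 'a = complex] unfolding filterlim_at of_real_0
    by (auto intro!: always_eventually simp del: of_real_inverse)
  have q: "Im ((F (of_real t) - F 0) / of_real t) = 0" if "0 \<le> t" for t
    unfolding F0 using root_line_of_real[OF y x that] unfolding F_def
    by (simp flip: of_real_diff of_real_divide)
  from inverse_lim have "(\<lambda>n. Im ((F (of_real (inverse (real (Suc n)))) - F 0) / of_real (inverse (real (Suc n))))) \<longlonglongrightarrow> Im D"
    by (intro tendsto_Im filterlim_compose[OF lim])
  moreover have "(\<lambda>n. Im ((F (of_real (inverse (real (Suc n)))) - F 0) / of_real (inverse (real (Suc n))))) = (\<lambda>n. 0)"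
    by (intro ext q) simp
  ultimately have ImD: "Im D = 0"
    by (simp only: LIMSEQ_const_iff)
  have "\<forall>\<^sub>F s in at 0. dist ((F s - F 0) / s) D < e"
    using tendstoD[OF lim e] .
  then obtain \<delta> where \<delta>: "0 < \<delta>" "\<And>s. s \<noteq> 0 \<Longrightarrow> norm s < \<delta> \<Longrightarrow> dist ((F s - F 0) / s) D < e"
    by (auto simp: eventually_at dist_norm)
  show thesis
  \<comment> \<open>The factor 2 makes \<open>norm (1 / s) < \<delta>\<close> strict.\<close>
  proof (rule that[of "2 / \<delta>"])
    fix s assume s: "2 / \<delta> \<le> norm s" "0 < Im s"
    then have s0: "s \<noteq> 0"
      by auto
    have "0 < 2 / \<delta>"
      using \<delta>(1) by simp
    then have "norm (1 / s) < \<delta>"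
      using s s0 \<delta>(1) by (simp add: norm_divide field_simps)
    then have "dist ((F (1 / s) - F 0) / (1 / s)) D < e"
      using s0 by (intro \<delta>(2)) auto
    moreover have "(F (1 / s) - F 0) / (1 / s) = root_line x y s - s * of_real (posy A c y powr (1 / d))"
      using root_line_inverse[OF x y s(2)] s0 by (simp add: F_def field_simps flip: F0)
    ultimately show "\<bar>Im (root_line x y s - s * of_real (posy A c y powr (1 / d)))\<bar> < e"
      using abs_Im_le_cmod[of "root_line x y s - s * of_real (posy A c y powr (1 / d)) - D"] ImD
      by (simp add: dist_norm)
  qed (use \<delta> in simp)
qed

text \<open>The maximum principle for \<open>exp (\<i> * k s)\<close>, of modulus
  \<open>exp (- Im (k s))\<close>, on a disc segment above height \<open>\<eta>\<close>: the flat
  edge uses \<open>Im_root_line_nonneg\<close>, the arc the behaviour at infinity. Height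
  \<open>\<eta> > 0\<close> avoids the cut on the real axis.\<close>

lemma Im_root_line_ge:
  assumes x: "\<And>i. 0 < x $ i" and y: "\<And>i. 0 < y $ i" and s: "0 < Im s"
  shows "posy A c y powr (1 / d) * Im s \<le> Im (root_line x y s)"
proof -
  define g where "g = posy A c y powr (1 / d)"
  define k where "k = (\<lambda>s. root_line x y s - s * of_real g)"
  have g: "0 \<le> g"
    by (simp add: g_def)
  have hol: "k holomorphic_on {s. 0 < Im s}"
    unfolding k_def using in_line_domain[OF y]
    by (intro holomorphic_intros holomorphic_on_subset[OF holomorphic_root_line[OF y]]) auto
  have "0 \<le> Im (k s) + e" if e: "0 < e" for e
  proof -
    obtain R where R: "0 < R" "\<And>s. R \<le> norm s \<Longrightarrow> 0 < Im s \<Longrightarrow> \<bar>Im (k s)\<bar> < e"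
      using root_line_at_infinity[OF x y e] unfolding k_def g_def by blast
    \<comment> \<open>Small enough for \<open>s \<in> S\<close> and
      \<open>g * \<eta> \<le> e\<close>; the summand 1 covers \<open>g = 0\<close>.\<close>
    define \<eta> where "\<eta> = min (Im s) (e / (g + 1))"
    have \<eta>: "0 < \<eta>" "\<eta> \<le> Im s" "\<eta> \<le> e / (g + 1)"
      using s e g by (auto simp: \<eta>_def)
    have "g * \<eta> \<le> (g + 1) * \<eta>"
      using \<eta>(1) by (intro mult_right_mono) auto
    also have "\<dots> \<le> e"
      using \<eta>(3) g by (simp add: pos_le_divide_eq mult.commute)
    finally have g\<eta>: "g * \<eta> \<le> e" .
    define M where "M = max R (norm s)"
    define S where "S = {s. \<eta> \<le> Im s} \<inter> cball 0 M"
    have clS: "closed S"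
      unfolding S_def by (intro closed_Int closed_cball closed_Collect_le continuous_intros)
    have "S \<subseteq> {s. 0 < Im s}"
      using \<eta>(1) by (auto simp: S_def)
    then have holS: "(\<lambda>s. exp (\<i> * k s)) holomorphic_on S"
      by (intro holomorphic_intros holomorphic_on_subset[OF hol])
    have "norm (exp (\<i> * k s)) \<le> exp e"
    proof (rule maximum_modulus_frontier[where S = S and f = "\<lambda>s. exp (\<i> * k s)" and \<xi> = s])
      show "(\<lambda>s. exp (\<i> * k s)) holomorphic_on interior S"
        by (rule holomorphic_on_subset[OF holS interior_subset])
      show "continuous_on (closure S) (\<lambda>s. exp (\<i> * k s))"
        using holomorphic_on_imp_continuous_on[OF holS] by (simp only: closure_closed[OF clS])
      show "bounded S"
        unfolding S_def by (intro bounded_Int disjI2 bounded_cball)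
      show "s \<in> S"
        using \<eta>(2) by (auto simp: S_def M_def)
      fix w assume w: "w \<in> frontier S"
      have wS: "w \<in> S"
        using w clS frontier_subset_closed by blast
      have "{s. \<eta> < Im s} \<inter> ball 0 M \<subseteq> interior S"
        by (intro interior_maximal open_Int open_ball open_Collect_less continuous_intros) (auto simp: S_def)
      then have "w \<notin> {s. \<eta> < Im s} \<inter> ball 0 M"
        using w by (auto simp: frontier_def)
      then have "Im w = \<eta> \<or> M \<le> norm w"
        using wS by (auto simp: S_def)
      then have "- Im (k w) \<le> e"
      proof
        assume "Im w = \<eta>"
        then have "Im (k w) = Im (root_line x y w) - g * \<eta>"
          by (simp add: k_def)
        then show ?thesis
          using Im_root_line_nonneg[OF y, of w x] g\<eta> \<eta>(1) \<open>Im w = \<eta>\<close> by simp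
      next
        assume "M \<le> norm w"
        then show ?thesis
          using R(2)[of w] wS \<eta>(1) by (auto simp: M_def S_def)
      qed
      then show "norm (exp (\<i> * k w)) \<le> exp e"
        by simp
    qed
    then show ?thesis
      by simp
  qed
  then have "0 \<le> Im (k s)"
    by (rule field_le_epsilon)
  then show ?thesis
    by (simp add: k_def g_def mult.commute)
qed

text \<open>On the nonnegative reals \<open>k\<close> is real, and \<open>Im k \<ge> 0\<close> above
  them, so by Cauchy-Riemann \<open>Re k\<close> is nondecreasing there. At 0 and 1 its values are
  \<open>g x\<close> and \<open>g (x + y) - g y\<close>.\<close>

lemma posy_root_superadditive:
  assumes x: "\<And>i. 0 < x $ i" and y: "\<And>i. 0 < y $ i"
  shows "posy A c x powr (1 / d) + posy A c y powr (1 / d) \<le> posy A c (x + y) powr (1 / d)"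
proof -
  define g where "g = (\<lambda>x. posy A c x powr (1 / d))"
  define k where "k = (\<lambda>s. root_line x y s - s * of_real (g y))"
  have k_real: "k (Complex t 0) = of_real (g (x + t *\<^sub>R y) - t * g y)" if "0 \<le> t" for t
    using root_line_of_real[OF x y that] by (simp add: k_def g_def Complex_eq)
  have hol: "k holomorphic_on line_domain x y"
    unfolding k_def by (intro holomorphic_intros holomorphic_root_line[OF y])
  have "Re (k (Complex 0 0)) \<le> Re (k (Complex 1 0))"
  proof (rule DERIV_nonneg_imp_nondecreasing[where f = "\<lambda>t. Re (k (Complex t 0))"])
    fix t :: real assume t: "0 \<le> t"
    then obtain D where D: "(k has_field_derivative D) (at (Complex t 0))"
      using hol of_real_in_line_domain[OF x y] holomorphic_on_open[OF open_line_domain]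
      by (metis complex_of_real_def)
    \<comment> \<open>\<open>Re D\<close> is the upward derivative of \<open>Im k\<close>, which
      starts at 0; were it negative, \<open>Im k\<close> would be negative just above the
      axis.\<close>
    have "0 \<le> Re D"
    proof (rule ccontr)
      assume "\<not> 0 \<le> Re D"
      then obtain \<delta> where \<delta>: "0 < \<delta>" "\<forall>h>0. h < \<delta> \<longrightarrow> Im (k (Complex t (0 + h))) < Im (k (Complex t 0))"
        using DERIV_neg_dec_right[OF Im_has_derivative_vertical[OF D]] by auto
      have "0 \<le> Im (k (Complex t (\<delta> / 2)))"
        using Im_root_line_ge[OF x y, of "Complex t (\<delta> / 2)"] \<delta>(1) by (simp add: k_def g_def mult.commute)
      then show False
        using \<delta>(1) \<delta>(2)[rule_format, of "\<delta> / 2"] k_real[OF t] by simp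
    qed
    then show "\<exists>D. ((\<lambda>t. Re (k (Complex t 0))) has_real_derivative D) (at t) \<and> 0 \<le> D"
      using Re_has_derivative_horizontal[OF D] by blast
  qed simp
  then show ?thesis
    using k_real[of 0] k_real[of 1] by (simp add: g_def)
qed

section \<open>From superadditivity to concavity\<close>

lemma posy_scaleR:
  assumes "0 < t" "\<And>i. 0 < x $ i"
  shows "posy A c (t *\<^sub>R x) = t powr d * posy A c x"
proof -
  have "(\<Prod>i\<in>UNIV. (t *\<^sub>R x) $ i powr a $ i) = t powr d * (\<Prod>i\<in>UNIV. x $ i powr a $ i)" if "a \<in> A" for a
  proof -
    have "(\<Prod>i\<in>UNIV. t powr a $ i) = t powr (\<Sum>i\<in>UNIV. a $ i)"
      using assms(1) by (simp add: powr_sum)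
    then show ?thesis
      using assms hom that by (simp add: powr_mult prod.distrib less_imp_le homogeneous_of_degree_def)
  qed
  then show ?thesis
    by (simp add: posy_def sum_distrib_left algebra_simps)
qed

lemma concave_on_posy_root: "concave_on {x. \<forall>i. 0 < x $ i} (\<lambda>x. posy A c x powr (1 / d))"
  unfolding concave_on_iff
proof (intro conjI ballI allI impI)
  show "convex {x :: real ^ 'n. \<forall>i. 0 < x $ i}"
    by (auto intro!: convexI simp: add_nonneg_pos add_pos_nonneg le_less)
  fix x y :: "real ^ 'n" and u v :: real
  assume "x \<in> {x. \<forall>i. 0 < x $ i}" "y \<in> {x. \<forall>i. 0 < x $ i}" and uv: "0 \<le> u" "0 \<le> v" "u + v = 1"
  then have xy: "\<And>i. 0 < x $ i" "\<And>i. 0 < y $ i"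
    by auto
  have scale: "posy A c (t *\<^sub>R z) powr (1 / d) = t * posy A c z powr (1 / d)"
    if "0 < t" "\<And>i. 0 < z $ i" for t z
    using that d posy_pos[OF posy nonempty, of z] by (simp add: posy_scaleR powr_mult powr_powr)
  show "u * posy A c x powr (1 / d) + v * posy A c y powr (1 / d) \<le> posy A c (u *\<^sub>R x + v *\<^sub>R y) powr (1 / d)"
  \<comment> \<open>A zero weight would move a point out of the open orthant, where superadditivity
    and scaling hold.\<close>
  proof (cases "u = 0 \<or> v = 0")
    case True
    then show ?thesis
      using uv by auto
  next
    case False
    then have "0 < u" "0 < v"
      using uv by auto
    then show ?thesis
      using posy_root_superadditive[of "u *\<^sub>R x" "v *\<^sub>R y"] xy by (simp add: scale)
  qed
qed

text \<open>\<open>ln p\<close> is \<open>d\<close> times the logarithm of the concave root, and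
  \<open>ln\<close> is concave and increasing.\<close>

lemma concave_on_ln_posy: "concave_on {x. \<forall>i. 0 < x $ i} (\<lambda>x. ln (posy A c x))"
  unfolding concave_on_iff
proof (intro conjI ballI allI impI)
  note root = concave_on_posy_root[unfolded concave_on_iff]
  show "convex {x :: real ^ 'n. \<forall>i. 0 < x $ i}"
    using root by blast
  fix x y :: "real ^ 'n" and u v :: real
  assume xy: "x \<in> {x. \<forall>i. 0 < x $ i}" "y \<in> {x. \<forall>i. 0 < x $ i}" and uv: "0 \<le> u" "0 \<le> v" "u + v = 1"
  define g where "g = (\<lambda>x. posy A c x powr (1 / d))"
  have z: "u *\<^sub>R x + v *\<^sub>R y \<in> {x. \<forall>i. 0 < x $ i}"
    using root xy uv by (metis convexD)
  have pos: "0 < posy A c z" if "z \<in> {x. \<forall>i. 0 < x $ i}" for z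
    using that posy_pos[OF posy nonempty, of z] by simp
  then have g: "0 < g z" "ln (posy A c z) = d * ln (g z)" if "z \<in> {x. \<forall>i. 0 < x $ i}" for z
    using pos[OF that] d by (auto simp: g_def ln_powr)
  have "u * ln (g x) + v * ln (g y) \<le> ln (u * g x + v * g y)"
    using ln_concave uv g(1)[OF xy(1)] g(1)[OF xy(2)] by (simp add: concave_on_iff)
  also have "\<dots> \<le> ln (g (u *\<^sub>R x + v *\<^sub>R y))"
  proof -
    have "0 < u * g x + v * g y"
      using g(1)[OF xy(1)] g(1)[OF xy(2)] uv by (smt (verit) mult_nonneg_nonneg mult_pos_pos)
    moreover have "u * g x + v * g y \<le> g (u *\<^sub>R x + v *\<^sub>R y)"
      using root xy uv unfolding g_def by blast
    ultimately show ?thesis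
      by simp
  qed
  finally have "d * (u * ln (g x) + v * ln (g y)) \<le> d * ln (g (u *\<^sub>R x + v *\<^sub>R y))"
    using d by (intro mult_left_mono) auto
  then show "u * ln (posy A c x) + v * ln (posy A c y) \<le> ln (posy A c (u *\<^sub>R x + v *\<^sub>R y))"
    unfolding g(2)[OF xy(1)] g(2)[OF xy(2)] g(2)[OF z] by (simp add: algebra_simps)
qed

end

theorem theorem1:
  fixes A :: "(real ^ 'n) set" and c :: "real ^ 'n \<Rightarrow> real" and d :: real
  assumes "posynomial A c"
    and "homogeneous_of_degree A d"
    and "0 < d"
    and "sector_stable 1 A c"
  shows "concave_on {x :: real ^ 'n. \<forall>i. 0 < x $ i} (\<lambda>x. posy A c x powr (1 / d)) \<and>
         concave_on {x :: real ^ 'n. \<forall>i. 0 < x $ i} (\<lambda>x. ln (posy A c x))"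
proof -
  obtain G where "homogeneous_posy_log A c d G"
    using homogeneous_posy_log_exists[OF assms] .
  then interpret homogeneous_posy_log A c d G .
  show ?thesis
    using concave_on_posy_root concave_on_ln_posy ..
qed

end
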